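(* Let $(B,+,\cdot)$ be a skew left brace with additive group $K$ and multiplicative group $C$. Let $(G,K,H,E)$ be a trifactorised group associated with $(B,+,\cdot)$, and let $L$ be a subset of $B$ (regarded also as a subset of $K\le G$). Then: (1) The following statements are equivalent: (a) $(L,+,\cdot)$ is a subbrace of $(B,+,\cdot)$; (b) $L$ is a subgroup of $K$ and $LE\cap H$ is a subgroup of $H$; (c) $L$ is a subgroup of $K$ and $LE\cap H$ is a subgroup of $\operatorname{N}_G(L)$; (d) $LE\cap LH$ is a subgroup of $G$. (2) The following statements are equivalent: (a) $L$ is a left ideal of $(B,+,\cdot)$; (b) $L$ is a subgroup of $K$ and $E$ is a subgroup of $\operatorname{N}_G(L)$; (c) $LE$ is a subgroup of $G$. (3) The following statements are equivalent: (a) $L$ is a strong left ideal of $(B,+,\cdot)$; (b) $L$ is a normal subgroup of $G$. (4) The following statements are equivalent: (a) $L$ is an ideal of $(B,+,\cdot)$; (b) $L$ is a normal subgroup of $G$ and $LE\cap H$ is a normal subgroup of $H$; (c) $LE\cap LH$ is a normal subgroup of $G$.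
   Context: A skew left brace $(B,+,\cdot)$ is a set with two group operations ($+$ not necessarily commutative) such that $a(b+c)=ab-a+ac$ for all $a,b,c\in B$. Its lambda map is the homomorphism $\lambda\colon (B,\cdot)\to\operatorname{Aut}(B,+)$, $\lambda_a(b)=-a+ab$. A subbrace is a subset that is a subgroup of both $(B,+)$ and $(B,\cdot)$. A left ideal is a subgroup $L$ of $(B,+)$ with $\lambda_a(L)\subseteq L$ for all $a\in B$; a strong left ideal is a left ideal that is normal in $(B,+)$; an ideal is a strong left ideal that is normal in $(B,\cdot)$. Trifactorised groups associated with a brace: let $K=(B,+)$, $C=(B,\cdot)$, let $\delta\colon C\to K$ be the identity map of $B$, and let $\eta\colon C\to E$ be a surjective group homomorphism with $\ker\eta\le\ker\lambda$. Then $E$ acts on $K$ by $\bar\lambda(\eta(c))=\lambda(c)$; put $G=K\rtimes E$ (with $K$, $E$ identified with their copies in $G$) and $H=\{\delta(c)\eta(c)\mid c\in C\}\le G$. The tuple $(G,K,H,E)$ is a trifactorised group associated with $B$; it satisfies $K\trianglelefteq G$, $G=KE=KH=HE$, $K\cap E=H\cap E=1$. For subsets $X,Y\subseteq G$, $XY=\{xy\mid x\in X,y\in Y\}$; $\operatorname{N}_G(L)$ is the normaliser of $L$ in $G$. *)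

theory Defs
  imports "HOL-Algebra.Algebra"
begin

text \<open>
  A skew left brace is carried by a ring record: its additive group is \<^term>\<open>add_monoid B\<close>
  (not assumed commutative) and its multiplicative group is \<^term>\<open>B\<close> itself, viewed as a monoid
  record.
\<close>

locale skew_left_brace =
  fixes B :: "('a, 'b) ring_scheme" (structure)
  assumes additive_group: "group (add_monoid B)"
    and multiplicative_group: "group B"
    and brace_distrib: "\<lbrakk>a \<in> carrier B; b \<in> carrier B; c \<in> carrier B\<rbrakk>
      \<Longrightarrow> a \<otimes> (b \<oplus> c) = a \<otimes> b \<ominus> a \<oplus> a \<otimes> c"

text \<open>Restricted to the carrier, because the elements of \<^const>\<open>AutoGroup\<close> are extensional.\<close>

definition brace_lambda :: "('a, 'b) ring_scheme \<Rightarrow> 'a \<Rightarrow> 'a \<Rightarrow> 'a" where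
  "brace_lambda B a = (\<lambda>b \<in> carrier B. \<ominus>\<^bsub>B\<^esub> a \<oplus>\<^bsub>B\<^esub> a \<otimes>\<^bsub>B\<^esub> b)"

definition subbrace :: "'a set \<Rightarrow> ('a, 'b) ring_scheme \<Rightarrow> bool" where
  "subbrace L B \<longleftrightarrow> subgroup L (add_monoid B) \<and> subgroup L B"

definition left_ideal :: "'a set \<Rightarrow> ('a, 'b) ring_scheme \<Rightarrow> bool" where
  "left_ideal L B \<longleftrightarrow>
     subgroup L (add_monoid B) \<and> (\<forall>a \<in> carrier B. brace_lambda B a ` L \<subseteq> L)"

definition strong_left_ideal :: "'a set \<Rightarrow> ('a, 'b) ring_scheme \<Rightarrow> bool" where
  "strong_left_ideal L B \<longleftrightarrow> left_ideal L B \<and> L \<lhd> add_monoid B"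

definition brace_ideal :: "'a set \<Rightarrow> ('a, 'b) ring_scheme \<Rightarrow> bool" where
  "brace_ideal L B \<longleftrightarrow> strong_left_ideal L B \<and> L \<lhd> B"

definition semidirect_product ::
    "('k, 'm) monoid_scheme \<Rightarrow> ('e, 'n) monoid_scheme \<Rightarrow> ('e \<Rightarrow> 'k \<Rightarrow> 'k) \<Rightarrow> ('k \<times> 'e) monoid" where
  "semidirect_product K E \<phi> =
     \<lparr>carrier = carrier K \<times> carrier E,
      monoid.mult = (\<lambda>(k, e) (k', e'). (k \<otimes>\<^bsub>K\<^esub> \<phi> e k', e \<otimes>\<^bsub>E\<^esub> e')),
      one = (\<one>\<^bsub>K\<^esub>, \<one>\<^bsub>E\<^esub>)\<rparr>"

locale trifactorised_group =
  skew_left_brace B + E: group E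
  for B :: "('a, 'b) ring_scheme" (structure) and E :: "('e, 'c) monoid_scheme" +
  fixes \<eta> :: "'a \<Rightarrow> 'e"
  assumes eta_epi: "\<eta> \<in> epi B E"
    and ker_eta_le: "kernel B E \<eta> \<subseteq> kernel B (AutoGroup (add_monoid B)) (brace_lambda B)"

text \<open>
  The induced action of \<^term>\<open>E\<close> on the additive group. The choice of a preimage under \<^term>\<open>\<eta>\<close> is
  irrelevant, as shown by \<open>induced_action_eta\<close> below.
\<close>

definition induced_action ::
    "('a, 'b) ring_scheme \<Rightarrow> ('a \<Rightarrow> 'e) \<Rightarrow> 'e \<Rightarrow> 'a \<Rightarrow> 'a" where
  "induced_action B \<eta> e = brace_lambda B (inv_into (carrier B) \<eta> e)"

definition tri_G ::
    "('a, 'b) ring_scheme \<Rightarrow> ('e, 'c) monoid_scheme \<Rightarrow> ('a \<Rightarrow> 'e) \<Rightarrow> ('a \<times> 'e) monoid" where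
  "tri_G B E \<eta> = semidirect_product (add_monoid B) E (induced_action B \<eta>)"

definition embed_K :: "('e, 'c) monoid_scheme \<Rightarrow> 'a \<Rightarrow> 'a \<times> 'e" where
  "embed_K E k = (k, \<one>\<^bsub>E\<^esub>)"

definition embed_E :: "('a, 'b) ring_scheme \<Rightarrow> 'e \<Rightarrow> 'a \<times> 'e" where
  "embed_E B e = (\<zero>\<^bsub>B\<^esub>, e)"

definition tri_H ::
    "('a, 'b) ring_scheme \<Rightarrow> ('e, 'c) monoid_scheme \<Rightarrow> ('a \<Rightarrow> 'e) \<Rightarrow> ('a \<times> 'e) set" where
  "tri_H B E \<eta> = {embed_K E c \<otimes>\<^bsub>tri_G B E \<eta>\<^esub> embed_E B (\<eta> c) | c. c \<in> carrier B}"

context skew_left_brace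
begin

sublocale A: group "add_monoid B"
  rewrites "carrier (add_monoid B) = carrier B"
    and "monoid.mult (add_monoid B) = (\<oplus>)"
    and "monoid.one (add_monoid B) = \<zero>"
    and "m_inv (add_monoid B) = (\<lambda>x. \<ominus> x)"
  by (simp_all add: additive_group a_inv_def fun_eq_iff)

sublocale M: group B
  by (rule multiplicative_group)

lemma mult_zero_right: "a \<in> carrier B \<Longrightarrow> a \<otimes> \<zero> = a"
proof -
  assume a: "a \<in> carrier B"
  have "a \<otimes> \<zero> = a \<otimes> \<zero> \<ominus> a \<oplus> a \<otimes> \<zero>"
    using brace_distrib[of a "\<zero>" "\<zero>"] a by simp
  then have "\<zero> = \<ominus> a \<oplus> a \<otimes> \<zero>"
    using a by (simp add: a_minus_def A.m_assoc)
  then show ?thesis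
    using a by (metis A.inv_closed A.inv_equality A.inv_inv A.one_closed M.m_closed)
qed

lemma zero_eq_one: "\<zero> = \<one>"
  using mult_zero_right[of "\<one>"] by simp

lemma lambda_apply: "b \<in> carrier B \<Longrightarrow> brace_lambda B a b = \<ominus> a \<oplus> a \<otimes> b"
  by (simp add: brace_lambda_def)

lemma lambda_closed: "\<lbrakk>a \<in> carrier B; b \<in> carrier B\<rbrakk> \<Longrightarrow> brace_lambda B a b \<in> carrier B"
  by (simp add: brace_lambda_def)

lemma lambda_add:
  "\<lbrakk>a \<in> carrier B; b \<in> carrier B; c \<in> carrier B\<rbrakk>
    \<Longrightarrow> brace_lambda B a (b \<oplus> c) = brace_lambda B a b \<oplus> brace_lambda B a c"
  by (simp add: lambda_apply brace_distrib a_minus_def A.m_assoc)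

lemma mult_eq: "\<lbrakk>a \<in> carrier B; b \<in> carrier B\<rbrakk> \<Longrightarrow> a \<otimes> b = a \<oplus> brace_lambda B a b"
  by (simp add: lambda_apply A.m_assoc[symmetric])

lemma lambda_mult:
  assumes "a \<in> carrier B" "b \<in> carrier B" "c \<in> carrier B"
  shows "brace_lambda B (a \<otimes> b) c = brace_lambda B a (brace_lambda B b c)"
proof -
  have "a \<otimes> b \<oplus> brace_lambda B (a \<otimes> b) c = a \<otimes> (b \<otimes> c)"
    using assms by (simp add: mult_eq[symmetric] M.m_assoc)
  also have "\<dots> = a \<oplus> (brace_lambda B a b \<oplus> brace_lambda B a (brace_lambda B b c))"
    using assms mult_eq[of b c] mult_eq[of a "b \<otimes> c"]
    by (simp add: lambda_add lambda_closed)
  also have "\<dots> = a \<otimes> b \<oplus> brace_lambda B a (brace_lambda B b c)"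
    using assms by (simp add: A.m_assoc lambda_closed mult_eq[of a b])
  finally show ?thesis
    using assms by (simp add: lambda_closed)
qed

lemma lambda_one: "b \<in> carrier B \<Longrightarrow> brace_lambda B \<one> b = b"
  using zero_eq_one M.l_one A.l_one A.inv_one by (metis lambda_apply)

lemma lambda_auto: "a \<in> carrier B \<Longrightarrow> brace_lambda B a \<in> auto (add_monoid B)"
proof -
  assume a: "a \<in> carrier B"
  have "bij_betw (brace_lambda B a) (carrier B) (carrier B)"
  proof (rule bij_betw_byWitness[where f' = "brace_lambda B (inv a)"])
    show "\<forall>b\<in>carrier B. brace_lambda B (inv a) (brace_lambda B a b) = b"
      using a by (simp add: lambda_mult[symmetric] lambda_one)
    show "\<forall>b\<in>carrier B. brace_lambda B a (brace_lambda B (inv a) b) = b"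
      using a by (simp add: lambda_mult[symmetric] lambda_one)
  qed (use a lambda_closed in auto)
  then show ?thesis
    using a lambda_add[OF a] lambda_closed[OF a]
    by (simp add: auto_def Bij_def hom_def Pi_def) (simp add: brace_lambda_def)
qed

lemma lambda_hom: "brace_lambda B \<in> hom B (AutoGroup (add_monoid B))"
proof (rule homI)
  fix a b assume ab: "a \<in> carrier B" "b \<in> carrier B"
  have "brace_lambda B (a \<otimes> b) = compose (carrier B) (brace_lambda B a) (brace_lambda B b)"
  proof
    fix c
    show "brace_lambda B (a \<otimes> b) c = compose (carrier B) (brace_lambda B a) (brace_lambda B b) c"
      using ab lambda_mult by (cases "c \<in> carrier B") (auto simp: compose_def brace_lambda_def)
  qed
  then show "brace_lambda B (a \<otimes> b) = brace_lambda B a \<otimes>\<^bsub>AutoGroup (add_monoid B)\<^esub> brace_lambda B b"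
    using lambda_auto[OF ab(1)] lambda_auto[OF ab(2)]
    by (simp add: AutoGroup_def BijGroup_def auto_def)
qed (simp add: AutoGroup_def lambda_auto)

end

context trifactorised_group
begin

lemma induced_action_eta:
  assumes c: "c \<in> carrier B"
  shows "induced_action B \<eta> (\<eta> c) = brace_lambda B c"
proof -
  define d where "d = inv_into (carrier B) \<eta> (\<eta> c)"
  have d: "d \<in> carrier B" "\<eta> d = \<eta> c"
    using c unfolding d_def by (auto intro: inv_into_into f_inv_into_f)
  interpret eta: group_hom B E \<eta>
    using eta_epi by unfold_locales (auto simp: epi_def)
  interpret lam: group_hom B "AutoGroup (add_monoid B)" "brace_lambda B"
    by (rule group_hom.intro)
      (auto intro: multiplicative_group group.AutoGroup[OF additive_group] lambda_hom
        simp: group_hom_axioms_def)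
  have "d \<otimes> inv c \<in> kernel B E \<eta>"
    using c d by (simp add: kernel_def)
  then have "d \<otimes> inv c \<in> kernel B (AutoGroup (add_monoid B)) (brace_lambda B)"
    using ker_eta_le by blast
  then have "brace_lambda B (d \<otimes> inv c) = \<one>\<^bsub>AutoGroup (add_monoid B)\<^esub>"
    by (simp add: kernel_def)
  then have "brace_lambda B (d \<otimes> inv c \<otimes> c) = brace_lambda B c"
    using c d by (metis lam.H.l_one lam.hom_closed lam.hom_mult M.inv_closed M.m_closed)
  then show ?thesis
    using c d by (simp add: induced_action_def d_def[symmetric] M.m_assoc)
qed

end

end

theory Submission
  imports Defs
begin

text \<open>
  Every subset of the semidirect product that occurs here can be written down in coordinates
  \<open>(k, e)\<close> with \<open>k \<in> K\<close> and \<open>e \<in> E\<close>. The subgroup \<open>H\<close> is the graph of \<open>\<eta>\<close>, and \<open>c \<mapsto> (c, \<eta> c)\<close> is an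
  injective homomorphism from the multiplicative group, because \<open>cd = c + \<lambda>\<^sub>c(d)\<close>. The set
  \<open>LE\<close> is the rectangle \<open>L \<times> E\<close>, so \<open>LE \<inter> H\<close> is the image of \<open>L\<close> under that homomorphism: it is a
  (normal) subgroup of \<open>H\<close> exactly when \<open>L\<close> is one of the multiplicative group. Likewise
  conjugating \<open>(l, 1)\<close> by \<open>(k, e)\<close> gives \<open>k + e\<cdot>l - k\<close>, so the conditions on left ideals and strong left
  ideals become conditions on \<open>L\<close>, as a subset of \<open>G\<close>, being normalised by \<open>E\<close> or by all of \<open>G\<close>.

  If \<open>L\<close> is an additive subgroup, then \<open>LE \<inter> LH\<close> is the rectangle \<open>L \<times> \<eta>(L)\<close>. A rectangle \<open>L \<times> S\<close> of
  subgroups is a subgroup as soon as \<open>S\<close> maps \<open>L\<close> into itself (\<open>subgroup_Times\<close>), which applies to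
  \<open>S = E\<close> for left ideals and to \<open>S = \<eta>(L)\<close> for subbraces. In the other direction
  nothing is lost in passing to \<open>LE \<inter> LH\<close>: if it is a subgroup, it meets \<open>K\<close> in \<open>L\<close> and \<open>H\<close> in
  \<open>LE \<inter> H\<close>, so both are subgroups. If it is normal in \<open>G\<close>, then so is \<open>L\<close>, because \<open>K\<close> is, and \<open>LE \<inter> H\<close>
  is normal in \<open>H\<close>.

  The one point that needs more than coordinates is that \<open>L \<times> \<eta>(L)\<close> is normal when \<open>L\<close> is an ideal.
  Conjugation by \<open>(k, 1)\<close> sends \<open>(l, \<eta> m)\<close> to \<open>(k + l - \<lambda>\<^sub>m(k), \<eta> m)\<close>, so it has to be shown that
  \<open>\<lambda>\<^sub>m\<close> acts trivially modulo \<open>L\<close> for \<open>m \<in> L\<close> (\<open>act_eta_cong\<close>). Multiplicative normality makes this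
  possible, by rewriting \<open>mk = km'\<close> with \<open>m' \<in> L\<close>.
\<close>

section \<open>Subgroups, injective homomorphisms and normalisers\<close>

lemma inj_hom_subgroup_image_iff:
  assumes "group_hom A F h" and "inj_on h (carrier A)" and L: "L \<subseteq> carrier A"
  shows "subgroup (h ` L) F \<longleftrightarrow> subgroup L A"
proof
  interpret group_hom A F h by fact
  have mem: "x \<in> L" if "x \<in> carrier A" "h x \<in> h ` L" for x
    using that assms(2) L by (meson inj_on_image_mem_iff)
  assume sub: "subgroup (h ` L) F"
  show "subgroup L A"
  proof (rule G.subgroupI)
    show "L \<noteq> {}" using subgroup.one_closed[OF sub] by blast
    show "inv\<^bsub>A\<^esub> a \<in> L" if "a \<in> L" for a
      using mem[of "inv\<^bsub>A\<^esub> a"] subgroup.m_inv_closed[OF sub, of "h a"] that L by auto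
    show "a \<otimes>\<^bsub>A\<^esub> b \<in> L" if "a \<in> L" "b \<in> L" for a b
      using mem[of "a \<otimes>\<^bsub>A\<^esub> b"] subgroup.m_closed[OF sub, of "h a" "h b"] that L
      by (auto simp: subset_iff)
  qed (rule L)
qed (rule group_hom.subgroup_img_is_subgroup[OF assms(1)])

lemma inj_hom_normal_image_iff:
  assumes hom: "group_hom A F h" and inj: "inj_on h (carrier A)" and L: "L \<subseteq> carrier A"
  shows "h ` L \<lhd> F\<lparr>carrier := h ` carrier A\<rparr> \<longleftrightarrow> L \<lhd> A"
proof
  interpret group_hom A F h by fact
  let ?F = "F\<lparr>carrier := h ` carrier A\<rparr>"
  have hom': "group_hom A ?F h"
    using induced_group_hom[OF G.subgroup_self] by simp
  interpret im: group_hom A ?F h by fact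
  show "h ` L \<lhd> ?F" if "L \<lhd> A"
    using normal.surj_hom_normal_subgroup[OF that hom'] by simp
  assume N: "h ` L \<lhd> ?F"
  show "L \<lhd> A"
    unfolding G.normal_inv_iff
  proof (intro conjI ballI)
    show "subgroup L A"
      using inj_hom_subgroup_image_iff[OF hom' inj L] normal_imp_subgroup[OF N] by simp
    fix x l assume x: "x \<in> carrier A" and l: "l \<in> L"
    then have l': "l \<in> carrier A" using L by blast
    have "h x \<otimes>\<^bsub>?F\<^esub> h l \<otimes>\<^bsub>?F\<^esub> inv\<^bsub>?F\<^esub> h x \<in> h ` L"
      using N x l unfolding im.normal_inv_iff by auto
    also have "h x \<otimes>\<^bsub>?F\<^esub> h l \<otimes>\<^bsub>?F\<^esub> inv\<^bsub>?F\<^esub> h x = h (x \<otimes>\<^bsub>A\<^esub> l \<otimes>\<^bsub>A\<^esub> inv\<^bsub>A\<^esub> x)"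
      using x l' im.hom_inv[OF x] by (simp del: im.hom_inv hom_inv)
    finally show "x \<otimes>\<^bsub>A\<^esub> l \<otimes>\<^bsub>A\<^esub> inv\<^bsub>A\<^esub> x \<in> L"
      using x l' L inj by (meson inj_on_image_mem_iff G.m_closed G.inv_closed)
  qed
qed

text \<open>
  The normaliser asks for \<open>gLg\<inverse> = L\<close>. For a whole subgroup of normalising elements the
  inclusion suffices, since it holds for \<open>g\<inverse>\<close> as well.
\<close>

lemma (in group) subgroup_normalizer_iff:
  assumes L: "L \<subseteq> carrier G"
  shows "subgroup S (G\<lparr>carrier := normalizer G L\<rparr>) \<longleftrightarrow>
    subgroup S G \<and> (\<forall>s \<in> S. \<forall>l \<in> L. s \<otimes> l \<otimes> inv s \<in> L)"
proof -
  have conj: "g <# L #> inv g = (\<lambda>l. g \<otimes> l \<otimes> inv g) ` L" for g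
    by (auto simp: l_coset_def r_coset_def)
  have norm: "normalizer G L = {g \<in> carrier G. (\<lambda>l. g \<otimes> l \<otimes> inv g) ` L = L}"
    using L by (simp add: normalizer_def stabilizer_def conj)
  show ?thesis
  proof
    assume "subgroup S (G\<lparr>carrier := normalizer G L\<rparr>)"
    moreover from this have "S \<subseteq> normalizer G L"
      using subgroup.subset by fastforce
    ultimately show "subgroup S G \<and> (\<forall>s \<in> S. \<forall>l \<in> L. s \<otimes> l \<otimes> inv s \<in> L)"
      using incl_subgroup[OF normalizer_imp_subgroup[OF L]] unfolding norm by auto
  next
    assume R: "subgroup S G \<and> (\<forall>s \<in> S. \<forall>l \<in> L. s \<otimes> l \<otimes> inv s \<in> L)"
    then interpret S: subgroup S G by simp
    have "s \<in> normalizer G L" if s: "s \<in> S" for s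
    proof -
      have "l \<in> (\<lambda>l. s \<otimes> l \<otimes> inv s) ` L" if l: "l \<in> L" for l
      proof
        show "inv s \<otimes> l \<otimes> inv (inv s) \<in> L"
          using R s l by blast
        show "l = s \<otimes> (inv s \<otimes> l \<otimes> inv (inv s)) \<otimes> inv s"
          using s l L by (simp add: m_assoc[symmetric] subset_iff) (simp add: m_assoc subset_iff)
      qed
      then show ?thesis
        using R s by (auto simp: norm)
    qed
    then show "subgroup S (G\<lparr>carrier := normalizer G L\<rparr>)"
      using R subgroup_incl normalizer_imp_subgroup[OF L] by blast
  qed
qed

section \<open>Semidirect products\<close>

locale semidirect_action =
  K: group K + E: group E
  for K :: "('k, 'm) monoid_scheme" and E :: "('e, 'n) monoid_scheme" +
  fixes \<phi> :: "'e \<Rightarrow> 'k \<Rightarrow> 'k"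
  assumes act_closed: "\<lbrakk>e \<in> carrier E; k \<in> carrier K\<rbrakk> \<Longrightarrow> \<phi> e k \<in> carrier K"
    and act_mult: "\<lbrakk>e \<in> carrier E; k \<in> carrier K; k' \<in> carrier K\<rbrakk>
      \<Longrightarrow> \<phi> e (k \<otimes>\<^bsub>K\<^esub> k') = \<phi> e k \<otimes>\<^bsub>K\<^esub> \<phi> e k'"
    and act_comp: "\<lbrakk>e \<in> carrier E; e' \<in> carrier E; k \<in> carrier K\<rbrakk>
      \<Longrightarrow> \<phi> (e \<otimes>\<^bsub>E\<^esub> e') k = \<phi> e (\<phi> e' k)"
    and act_id: "k \<in> carrier K \<Longrightarrow> \<phi> \<one>\<^bsub>E\<^esub> k = k"
begin

abbreviation "P \<equiv> semidirect_product K E \<phi>"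

lemma carrier_semidirect: "carrier P = carrier K \<times> carrier E"
  by (simp add: semidirect_product_def)

lemma mult_semidirect: "(k, e) \<otimes>\<^bsub>P\<^esub> (k', e') = (k \<otimes>\<^bsub>K\<^esub> \<phi> e k', e \<otimes>\<^bsub>E\<^esub> e')"
  by (simp add: semidirect_product_def)

lemma one_semidirect: "\<one>\<^bsub>P\<^esub> = (\<one>\<^bsub>K\<^esub>, \<one>\<^bsub>E\<^esub>)"
  by (simp add: semidirect_product_def)

lemma act_one: "e \<in> carrier E \<Longrightarrow> \<phi> e \<one>\<^bsub>K\<^esub> = \<one>\<^bsub>K\<^esub>"
  by (metis K.l_cancel_one' K.one_closed K.r_one act_closed act_mult)

lemma act_inv: "\<lbrakk>e \<in> carrier E; k \<in> carrier K\<rbrakk> \<Longrightarrow> \<phi> e (inv\<^bsub>K\<^esub> k) = inv\<^bsub>K\<^esub> \<phi> e k"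
  by (metis K.inv_closed K.inv_equality K.l_inv act_closed act_mult act_one)

lemma group_semidirect: "group P"
proof (rule groupI)
  fix x assume "x \<in> carrier P"
  then obtain k e where x: "x = (k, e)" "k \<in> carrier K" "e \<in> carrier E"
    by (auto simp: carrier_semidirect)
  then show "\<exists>y \<in> carrier P. y \<otimes>\<^bsub>P\<^esub> x = \<one>\<^bsub>P\<^esub>"
    by (intro bexI[of _ "(\<phi> (inv\<^bsub>E\<^esub> e) (inv\<^bsub>K\<^esub> k), inv\<^bsub>E\<^esub> e)"])
      (auto simp: carrier_semidirect mult_semidirect one_semidirect act_closed act_inv)
qed (auto simp: carrier_semidirect mult_semidirect one_semidirect act_closed act_mult act_comp
    act_id K.m_assoc E.m_assoc)

sublocale P: group P
  by (rule group_semidirect)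

lemma inv_semidirect:
  "\<lbrakk>k \<in> carrier K; e \<in> carrier E\<rbrakk>
    \<Longrightarrow> inv\<^bsub>P\<^esub> (k, e) = (\<phi> (inv\<^bsub>E\<^esub> e) (inv\<^bsub>K\<^esub> k), inv\<^bsub>E\<^esub> e)"
  by (rule P.inv_equality)
    (auto simp: carrier_semidirect mult_semidirect one_semidirect act_closed act_inv)

lemma conj_semidirect:
  assumes "k \<in> carrier K" "e \<in> carrier E" "l \<in> carrier K" "s \<in> carrier E"
  shows "(k, e) \<otimes>\<^bsub>P\<^esub> (l, s) \<otimes>\<^bsub>P\<^esub> inv\<^bsub>P\<^esub> (k, e) =
    (k \<otimes>\<^bsub>K\<^esub> \<phi> e l \<otimes>\<^bsub>K\<^esub> \<phi> (e \<otimes>\<^bsub>E\<^esub> s \<otimes>\<^bsub>E\<^esub> inv\<^bsub>E\<^esub> e) (inv\<^bsub>K\<^esub> k),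
     e \<otimes>\<^bsub>E\<^esub> s \<otimes>\<^bsub>E\<^esub> inv\<^bsub>E\<^esub> e)"
  using assms by (simp add: inv_semidirect mult_semidirect act_comp[symmetric])

lemma conj_embed_K:
  assumes "k \<in> carrier K" "e \<in> carrier E" "l \<in> carrier K"
  shows "(k, e) \<otimes>\<^bsub>P\<^esub> embed_K E l \<otimes>\<^bsub>P\<^esub> inv\<^bsub>P\<^esub> (k, e) =
    embed_K E (k \<otimes>\<^bsub>K\<^esub> \<phi> e l \<otimes>\<^bsub>K\<^esub> inv\<^bsub>K\<^esub> k)"
  using conj_semidirect[OF assms E.one_closed] assms by (simp add: embed_K_def act_id)

lemma embed_K_hom: "group_hom K P (embed_K E)"
  by unfold_locales (auto simp: hom_def embed_K_def carrier_semidirect mult_semidirect act_id)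

lemma inj_embed_K: "inj (embed_K E)"
  by (auto simp: inj_def embed_K_def)

lemma embed_K_mem_iff: "embed_K E k \<in> embed_K E ` L \<longleftrightarrow> k \<in> L"
  by (simp add: inj_image_mem_iff[OF inj_embed_K])

lemma subgroup_embed_K_iff:
  "L \<subseteq> carrier K \<Longrightarrow> subgroup (embed_K E ` L) P \<longleftrightarrow> subgroup L K"
  by (rule inj_hom_subgroup_image_iff[OF embed_K_hom inj_on_subset[OF inj_embed_K]]) auto

text \<open>By \<open>conj_embed_K\<close>, conjugation by \<open>(k, e)\<close> is on \<open>K\<close> the action of \<open>e\<close> followed by conjugation by \<open>k\<close>;
  taking \<open>k = 1\<close> or \<open>e = 1\<close> separates the two conditions.\<close>

lemma normal_embed_K_iff:
  assumes L: "L \<subseteq> carrier K"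
  shows "embed_K E ` L \<lhd> P \<longleftrightarrow> L \<lhd> K \<and> (\<forall>e \<in> carrier E. \<phi> e ` L \<subseteq> L)"
proof -
  have "embed_K E ` L \<lhd> P \<longleftrightarrow> subgroup L K \<and>
      (\<forall>k \<in> carrier K. \<forall>e \<in> carrier E. \<forall>l \<in> L. k \<otimes>\<^bsub>K\<^esub> \<phi> e l \<otimes>\<^bsub>K\<^esub> inv\<^bsub>K\<^esub> k \<in> L)"
    using L by (simp add: P.normal_inv_iff subgroup_embed_K_iff carrier_semidirect conj_embed_K
        embed_K_mem_iff subset_iff)
  also have "\<dots> \<longleftrightarrow> L \<lhd> K \<and> (\<forall>e \<in> carrier E. \<phi> e ` L \<subseteq> L)"
    (is "_ \<and> ?conj \<longleftrightarrow> _")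
  proof
    assume sub: "subgroup L K \<and> ?conj"
    have "\<phi> e l \<in> L" if "e \<in> carrier E" "l \<in> L" for e l
      using sub that L act_closed[of e l] by (force dest: bspec[of _ _ "\<one>\<^bsub>K\<^esub>"])
    moreover have "k \<otimes>\<^bsub>K\<^esub> l \<otimes>\<^bsub>K\<^esub> inv\<^bsub>K\<^esub> k \<in> L" if "k \<in> carrier K" "l \<in> L" for k l
      using sub that L act_id[of l] E.one_closed by fastforce
    ultimately show "L \<lhd> K \<and> (\<forall>e \<in> carrier E. \<phi> e ` L \<subseteq> L)"
      using sub by (auto simp: K.normal_inv_iff)
  qed (auto simp: K.normal_inv_iff image_subset_iff)
  finally show ?thesis .
qed

lemma subgroup_embed_E_normalizer_iff:
  assumes L: "L \<subseteq> carrier K"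
  shows "subgroup ((\<lambda>e. (\<one>\<^bsub>K\<^esub>, e)) ` carrier E) (P\<lparr>carrier := normalizer P (embed_K E ` L)\<rparr>) \<longleftrightarrow>
    (\<forall>e \<in> carrier E. \<phi> e ` L \<subseteq> L)"
proof -
  have "embed_K E ` L \<subseteq> carrier P"
    using L by (auto simp: embed_K_def carrier_semidirect)
  moreover have "group_hom E P (\<lambda>e. (\<one>\<^bsub>K\<^esub>, e))"
    by unfold_locales (auto simp: hom_def carrier_semidirect mult_semidirect act_one)
  then have "subgroup ((\<lambda>e. (\<one>\<^bsub>K\<^esub>, e)) ` carrier E) P"
    by (rule group_hom.img_is_subgroup)
  ultimately show ?thesis
    using L act_closed
    by (auto simp add: P.subgroup_normalizer_iff conj_embed_K embed_K_mem_iff subset_iff)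
qed

text \<open>The inverse of \<open>(l, s)\<close> is \<open>(\<phi> s\<inverse> l\<inverse>, s\<inverse>)\<close>, in which \<open>s\<inverse>\<close> acts as an element of \<open>S\<close>.\<close>

lemma subgroup_Times:
  assumes "subgroup L K" and "subgroup S E" and inv: "\<And>e l. e \<in> S \<Longrightarrow> l \<in> L \<Longrightarrow> \<phi> e l \<in> L"
  shows "subgroup (L \<times> S) P"
proof -
  interpret L: subgroup L K by fact
  interpret S: subgroup S E by fact
  show ?thesis
  proof (rule P.subgroupI)
    show "L \<times> S \<noteq> {}"
      using L.one_closed S.one_closed by blast
  qed (auto simp: carrier_semidirect mult_semidirect inv_semidirect intro!: inv)
qed

text \<open>
  The set \<open>Y\<close> meets \<open>K\<close> exactly in \<open>L\<close>. This recovers the additive condition on \<open>L\<close> both from \<open>LE\<close>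
  and from \<open>LE \<inter> LH\<close>.
\<close>

lemma subgroup_between_imp_subgroup:
  assumes L: "L \<subseteq> carrier K" and Y: "subgroup Y P"
    and "embed_K E ` L \<subseteq> Y" and "Y \<subseteq> L \<times> carrier E"
  shows "subgroup L K"
proof -
  have "Y \<inter> embed_K E ` carrier K = embed_K E ` L"
    using assms by (auto simp: embed_K_def)
  then show ?thesis
    using P.subgroups_Inter_pair[OF Y group_hom.img_is_subgroup[OF embed_K_hom]]
      subgroup_embed_K_iff[OF L] by simp
qed

end

section \<open>Coordinates in a trifactorised group\<close>

context trifactorised_group
begin

abbreviation "act \<equiv> induced_action B \<eta>"

lemma eta_hom: "group_hom B E \<eta>"
  using eta_epi by unfold_locales (auto simp: epi_def)

sublocale eta: group_hom B E \<eta>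
  by (rule eta_hom)

lemma eta_surj: "\<eta> ` carrier B = carrier E"
  using eta_epi by (simp add: epi_def)

lemma eta_cases:
  assumes "e \<in> carrier E"
  obtains c where "c \<in> carrier B" "e = \<eta> c"
  using assms eta_surj by blast

lemma semidirect_action_brace: "semidirect_action (add_monoid B) E act"
proof (rule semidirect_action.intro[OF additive_group E.group_axioms], unfold_locales)
  show "act \<one>\<^bsub>E\<^esub> k = k" if "k \<in> carrier (add_monoid B)" for k
    using induced_action_eta[of "\<one>"] lambda_one that by simp
  show "act (e \<otimes>\<^bsub>E\<^esub> e') k = act e (act e' k)"
    if "e \<in> carrier E" "e' \<in> carrier E" "k \<in> carrier (add_monoid B)" for e e' k
  proof -
    obtain c where "c \<in> carrier B" "e = \<eta> c"
      using \<open>e \<in> carrier E\<close> by (rule eta_cases)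
    moreover obtain d where "d \<in> carrier B" "e' = \<eta> d"
      using \<open>e' \<in> carrier E\<close> by (rule eta_cases)
    ultimately show ?thesis
      using that induced_action_eta[of "c \<otimes> d"]
      by (simp add: induced_action_eta lambda_mult)
  qed
qed (auto simp: induced_action_eta lambda_closed lambda_add elim!: eta_cases)

sublocale sd: semidirect_action "add_monoid B" E act
  rewrites "semidirect_product (add_monoid B) E act = tri_G B E \<eta>"
    and "carrier (add_monoid B) = carrier B"
    and "monoid.mult (add_monoid B) = (\<oplus>)"
    and "monoid.one (add_monoid B) = \<zero>"
    and "m_inv (add_monoid B) = (\<lambda>x. \<ominus> x)"
  by (simp_all add: semidirect_action_brace tri_G_def a_inv_def fun_eq_iff)

abbreviation "G \<equiv> tri_G B E \<eta>"
abbreviation "H \<equiv> tri_H B E \<eta>"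

lemma act_eta:
  "\<lbrakk>c \<in> carrier B; k \<in> carrier B\<rbrakk> \<Longrightarrow> act (\<eta> c) k = \<ominus> c \<oplus> c \<otimes> k"
  by (simp add: induced_action_eta lambda_apply)

text \<open>Since \<open>\<eta>\<close> is surjective, invariance under \<open>\<lambda>\<close> is the same as invariance under the action of \<open>E\<close>.\<close>

lemma left_ideal_iff_act:
  "left_ideal L B \<longleftrightarrow> subgroup L (add_monoid B) \<and> (\<forall>e \<in> carrier E. act e ` L \<subseteq> L)"
  by (auto simp: left_ideal_def eta_surj[symmetric] induced_action_eta)

definition graph :: "'a \<Rightarrow> 'a \<times> 'e" where
  "graph c = (c, \<eta> c)"

text \<open>
  Multiplicativity is the identity \<open>cd = c + \<lambda>\<^sub>c(d)\<close>, so that \<open>H\<close> is a copy of the multiplicative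
  group inside \<open>G\<close>.
\<close>

lemma graph_hom: "group_hom B G graph"
  by unfold_locales
    (auto simp: hom_def graph_def sd.carrier_semidirect sd.mult_semidirect induced_action_eta
      mult_eq[symmetric])

lemma inj_graph: "inj graph"
  by (auto simp: inj_def graph_def)

lemma tri_H_eq: "H = graph ` carrier B"
proof -
  have "embed_K E c \<otimes>\<^bsub>G\<^esub> embed_E B (\<eta> c) = graph c" if "c \<in> carrier B" for c
    using that by (simp add: embed_K_def embed_E_def graph_def sd.mult_semidirect sd.act_id)
  then show ?thesis
    by (force simp: tri_H_def)
qed

lemma subgroup_tri_H: "subgroup H G"
  unfolding tri_H_eq by (rule group_hom.img_is_subgroup[OF graph_hom])

context
  fixes L :: "'a set"
  assumes L: "L \<subseteq> carrier B"
begin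

abbreviation "LE \<equiv> embed_K E ` L <#>\<^bsub>G\<^esub> embed_E B ` carrier E"
abbreviation "LH \<equiv> embed_K E ` L <#>\<^bsub>G\<^esub> H"

lemma LE_eq: "LE = L \<times> carrier E"
proof -
  have "embed_K E l \<otimes>\<^bsub>G\<^esub> embed_E B e = (l, e)" if "l \<in> L" "e \<in> carrier E" for l e
    using that L by (auto simp: embed_K_def embed_E_def sd.mult_semidirect sd.act_id)
  then show ?thesis
    by (force simp: set_mult_def)
qed

lemma LE_Int_H: "LE \<inter> H = graph ` L"
  using L by (auto simp: LE_eq tri_H_eq graph_def)

lemma LH_eq: "LH = {(l \<oplus> c, \<eta> c) | l c. l \<in> L \<and> c \<in> carrier B}"
proof -
  have "embed_K E l \<otimes>\<^bsub>G\<^esub> graph c = (l \<oplus> c, \<eta> c)" if "l \<in> L" "c \<in> carrier B" for l c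
    using that L by (auto simp: embed_K_def graph_def sd.mult_semidirect sd.act_id)
  then show ?thesis
    unfolding set_mult_def tri_H_eq by auto
qed

lemma embed_subset_LE_Int_LH: "embed_K E ` L \<subseteq> LE \<inter> LH"
proof
  fix x assume "x \<in> embed_K E ` L"
  then obtain l where "l \<in> L" "x = (l, \<one>\<^bsub>E\<^esub>)"
    by (auto simp: embed_K_def)
  then show "x \<in> LE \<inter> LH"
    using L eta.hom_one zero_eq_one A.r_one[of l] unfolding LE_eq LH_eq by force
qed

text \<open>If \<open>0 \<in> L\<close>, then \<open>H \<subseteq> LH\<close>, and \<open>LE \<inter> LH \<inter> H\<close> reduces to \<open>LE \<inter> H\<close>.\<close>

lemma LE_Int_LH_Int_H:
  assumes "\<zero> \<in> L"
  shows "LE \<inter> LH \<inter> H = graph ` L"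
proof -
  have "graph ` L \<subseteq> LH"
    using L assms unfolding LH_eq graph_def by force
  then show ?thesis
    using LE_Int_H by blast
qed

text \<open>
  An element of \<open>LH\<close> is \<open>(l + c, \<eta> c)\<close> with \<open>l \<in> L\<close>. For an additive subgroup \<open>L\<close> its first coordinate lies in \<open>L\<close> exactly
  when \<open>c\<close> does, and then any first coordinate in \<open>L\<close> can be reached by the choice of \<open>l\<close>.
\<close>

lemma LE_Int_LH_eq:
  assumes "subgroup L (add_monoid B)"
  shows "LE \<inter> LH = L \<times> \<eta> ` L"
proof -
  interpret L: subgroup L "add_monoid B" by fact
  have cancel: "c \<in> L" if "l \<in> L" "c \<in> carrier B" "l \<oplus> c \<in> L" for l c
  proof -
    have "\<ominus> l \<oplus> (l \<oplus> c) \<in> L"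
      using that L.m_closed[of "\<ominus> l" "l \<oplus> c"] L.m_inv_closed[of l] by (simp add: a_inv_def)
    then show ?thesis
      using that L by (simp add: A.m_assoc[symmetric] subset_iff)
  qed
  have LH: "(m, \<eta> c) \<in> LH" if "m \<in> L" "c \<in> L" for m c
  proof -
    have "m \<oplus> \<ominus> c \<in> L"
      using that L.m_closed[of m "\<ominus> c"] L.m_inv_closed[of c] by (simp add: a_inv_def)
    moreover have "m = (m \<oplus> \<ominus> c) \<oplus> c"
      using that L by (simp add: A.m_assoc subset_iff)
    ultimately show ?thesis
      using that L unfolding LH_eq by blast
  qed
  show ?thesis
  proof (intro equalityI subsetI)
    fix x assume x: "x \<in> LE \<inter> LH"
    obtain l c where lc: "l \<in> L" "c \<in> carrier B" "x = (l \<oplus> c, \<eta> c)"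
      using x unfolding LH_eq by blast
    moreover have "l \<oplus> c \<in> L"
      using x lc(3) unfolding LE_eq by simp
    ultimately show "x \<in> L \<times> \<eta> ` L"
      using cancel[of l c] by simp
  next
    fix x assume "x \<in> L \<times> \<eta> ` L"
    then obtain m c where "m \<in> L" "c \<in> L" "x = (m, \<eta> c)"
      by blast
    then show "x \<in> LE \<inter> LH"
      using LH[of m c] L eta.hom_closed[of c] unfolding LE_eq by blast
  qed
qed

section \<open>Subbraces\<close>

lemma subbrace_iff_subgroup_H:
  "subbrace L B \<longleftrightarrow> subgroup L (add_monoid B) \<and>
    subgroup (LE \<inter> H) (G\<lparr>carrier := H\<rparr>)"
proof -
  have "subgroup (graph ` L) G \<longleftrightarrow> subgroup L B"
    by (rule inj_hom_subgroup_image_iff[OF graph_hom inj_on_subset[OF inj_graph] L]) simp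
  moreover have "graph ` L \<subseteq> H"
    using L by (auto simp: tri_H_eq)
  ultimately show ?thesis
    using sd.P.incl_subgroup[OF subgroup_tri_H] sd.P.subgroup_incl[OF _ subgroup_tri_H]
    unfolding LE_Int_H subbrace_def by blast
qed

text \<open>
  Asking that \<open>LE \<inter> H\<close> normalise \<open>L\<close> adds no condition: conjugating \<open>l\<close> by \<open>(c, \<eta> c)\<close> gives
  \<open>c + \<lambda>\<^sub>c(l) - c = cl - c\<close>, which lies in a subbrace \<open>L\<close> together with \<open>c\<close> and \<open>l\<close>.
\<close>

lemma subbrace_iff_subgroup_normalizer:
  "subbrace L B \<longleftrightarrow> subgroup L (add_monoid B) \<and>
    subgroup (LE \<inter> H)
      (G\<lparr>carrier := normalizer G (embed_K E ` L)\<rparr>)"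
proof -
  have sub: "subgroup (graph ` L) G \<longleftrightarrow> subgroup L B"
    by (rule inj_hom_subgroup_image_iff[OF graph_hom inj_on_subset[OF inj_graph] L]) simp
  have "graph c \<otimes>\<^bsub>G\<^esub> embed_K E l \<otimes>\<^bsub>G\<^esub> inv\<^bsub>G\<^esub> graph c
      \<in> embed_K E ` L"
    if sb: "subbrace L B" and c: "c \<in> L" and l: "l \<in> L" for c l
  proof -
    have "c \<oplus> (\<ominus> c \<oplus> c \<otimes> l) = c \<otimes> l"
      using L l c by (simp add: A.m_assoc[symmetric] subset_iff)
    moreover have "c \<otimes> l \<oplus> \<ominus> c \<in> L"
      using sb c l subgroup.m_closed[of L B c l] subgroup.m_inv_closed[of L "add_monoid B" c]
        subgroup.m_closed[of L "add_monoid B" "c \<otimes> l" "\<ominus> c"]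
      by (simp add: subbrace_def a_inv_def)
    ultimately show ?thesis
      using L l c
      by (simp add: graph_def sd.conj_embed_K sd.embed_K_mem_iff act_eta subset_iff)
  qed
  moreover have "embed_K E ` L \<subseteq> carrier G"
    using L by (auto simp: embed_K_def sd.carrier_semidirect)
  ultimately show ?thesis
    using sub unfolding LE_Int_H subbrace_def by (auto simp: sd.P.subgroup_normalizer_iff)
qed

lemma subbrace_iff_subgroup_LE_Int_LH:
  "subbrace L B \<longleftrightarrow> subgroup (LE \<inter> LH) G"
proof
  assume sb: "subbrace L B"
  then have add: "subgroup L (add_monoid B)" and mult: "subgroup L B"
    by (auto simp: subbrace_def)
  have "\<ominus> c \<oplus> c \<otimes> l \<in> L" if "c \<in> L" "l \<in> L" for c l
    using that subgroup.m_closed[OF add, of "\<ominus> c" "c \<otimes> l"] subgroup.m_inv_closed[OF add, of c]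
      subgroup.m_closed[OF mult, of c l] by (simp add: a_inv_def)
  then have "subgroup (L \<times> \<eta> ` L) G"
    using L by (intro sd.subgroup_Times add eta.subgroup_img_is_subgroup mult)
      (auto simp: act_eta subset_iff)
  then show "subgroup (LE \<inter> LH) G"
    by (simp only: LE_Int_LH_eq[OF add])
next
  assume X: "subgroup (LE \<inter> LH) G"
  have add: "subgroup L (add_monoid B)"
    by (rule sd.subgroup_between_imp_subgroup[OF L X embed_subset_LE_Int_LH]) (simp add: LE_eq)
  then have "\<zero> \<in> L"
    using subgroup.one_closed[OF add] by simp
  then have "subgroup (graph ` L) G"
    using sd.P.subgroups_Inter_pair[OF X subgroup_tri_H] by (simp add: LE_Int_LH_Int_H)
  then show "subbrace L B"
    using add inj_hom_subgroup_image_iff[OF graph_hom inj_on_subset[OF inj_graph] L]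
    by (simp add: subbrace_def)
qed

section \<open>Left ideals and ideals\<close>

lemma left_ideal_iff_normalizer:
  "left_ideal L B \<longleftrightarrow> subgroup L (add_monoid B) \<and>
    subgroup (embed_E B ` carrier E)
      (G\<lparr>carrier := normalizer G (embed_K E ` L)\<rparr>)"
  using sd.subgroup_embed_E_normalizer_iff[OF L]
  by (simp add: left_ideal_iff_act embed_E_def[abs_def])

lemma left_ideal_iff_subgroup_LE:
  "left_ideal L B \<longleftrightarrow> subgroup LE G"
proof
  assume "left_ideal L B"
  then show "subgroup LE G"
    unfolding LE_eq left_ideal_iff_act
    by (intro sd.subgroup_Times E.subgroup_self) auto
next
  assume X: "subgroup LE G"
  have add: "subgroup L (add_monoid B)"
    using sd.subgroup_between_imp_subgroup[OF L X] embed_subset_LE_Int_LH by (auto simp: LE_eq)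
  have "act e l \<in> L" if "e \<in> carrier E" "l \<in> L" for e l
  proof -
    (* The product (0, e)(l, 1) = (e.l, e) exhibits the action inside LE. *)
    have "(\<zero>, e) \<otimes>\<^bsub>G\<^esub> (l, \<one>\<^bsub>E\<^esub>) \<in> L \<times> carrier E"
      using subgroup.m_closed[OF X] subgroup.one_closed[OF add] that by (simp add: LE_eq)
    then show ?thesis
      using that L by (simp add: sd.mult_semidirect sd.act_closed subset_iff)
  qed
  then show "left_ideal L B"
    using add by (auto simp: left_ideal_iff_act)
qed

lemma strong_left_ideal_iff_normal:
  "strong_left_ideal L B \<longleftrightarrow> embed_K E ` L \<lhd> G"
  using normal_imp_subgroup
  by (auto simp: strong_left_ideal_def left_ideal_iff_act sd.normal_embed_K_iff[OF L])

lemma brace_ideal_iff_normal_H: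
  "brace_ideal L B \<longleftrightarrow> embed_K E ` L \<lhd> G \<and>
    LE \<inter> H \<lhd> G\<lparr>carrier := H\<rparr>"
  using inj_hom_normal_image_iff[OF graph_hom inj_on_subset[OF inj_graph] L]
  unfolding brace_ideal_def strong_left_ideal_iff_normal LE_Int_H by (simp add: tri_H_eq)

text \<open>
  An ideal acts trivially on the additive group modulo itself. With \<open>m' = k\<inverse>mk \<in> L\<close> one has
  \<open>\<lambda>\<^sub>m(k) - k = -m + km' - k = -m + (k + \<lambda>\<^sub>k(m') - k)\<close>,
  which uses normality in both groups and invariance under \<open>\<lambda>\<close>.
\<close>

lemma act_eta_cong:
  assumes id: "brace_ideal L B" and m: "m \<in> L" and k: "k \<in> carrier B"
  shows "act (\<eta> m) k \<ominus> k \<in> L"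
proof -
  have add: "L \<lhd> add_monoid B" and mult: "L \<lhd> B"
    and act: "\<And>c l. c \<in> carrier B \<Longrightarrow> l \<in> L \<Longrightarrow> \<ominus> c \<oplus> c \<otimes> l \<in> L"
    using id L lambda_apply by (fastforce simp: brace_ideal_def strong_left_ideal_def left_ideal_def)+
  interpret N: subgroup L "add_monoid B"
    by (rule normal_imp_subgroup[OF add])
  define m' where "m' = inv k \<otimes> m \<otimes> k"
  have m': "m' \<in> L" "m' \<in> carrier B" "m \<in> carrier B"
    using normal.inv_op_closed1[OF mult k m] m L by (auto simp: m'_def)
  have "m \<otimes> k = k \<otimes> m'"
    using m' k by (simp add: m'_def M.m_assoc[symmetric])
  also have "\<dots> = k \<oplus> (\<ominus> k \<oplus> k \<otimes> m')"
    using m' k by (simp add: A.m_assoc[symmetric])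
  finally have "act (\<eta> m) k \<ominus> k = \<ominus> m \<oplus> (k \<oplus> (\<ominus> k \<oplus> k \<otimes> m') \<oplus> \<ominus> k)"
    using m' k by (simp add: act_eta a_minus_def A.m_assoc)
  moreover have "k \<oplus> (\<ominus> k \<oplus> k \<otimes> m') \<oplus> \<ominus> k \<in> L"
    using normal.inv_op_closed2[OF add, of k] act[OF k m'(1)] k by (simp add: a_inv_def)
  ultimately show ?thesis
    using N.m_closed[of "\<ominus> m"] N.m_inv_closed[OF m] by (simp add: a_inv_def)
qed

text \<open>
  For an ideal, the conjugate of \<open>(l, \<eta> m)\<close> by \<open>(k, \<eta> c)\<close> is \<open>(k + l' - \<lambda>\<^bsub>m'\<^esub>(k), \<eta> m')\<close> with
  \<open>l' = \<lambda>\<^sub>c(l)\<close> and \<open>m' = cmc\<inverse>\<close> in \<open>L\<close>. By \<open>act_eta_cong\<close> there is \<open>d \<in> L\<close> with \<open>\<lambda>\<^bsub>m'\<^esub>(k) = d + k\<close>, so the first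
  coordinate is \<open>(k + l' - k) - d\<close>. Conversely, intersecting the normal subgroup \<open>LE \<inter> LH\<close> with \<open>K\<close> and
  \<open>H\<close> gives the two normality conditions of \<open>brace_ideal_iff_normal_H\<close>.
\<close>

lemma brace_ideal_iff_normal_LE_Int_LH:
  "brace_ideal L B \<longleftrightarrow> LE \<inter> LH \<lhd> G"
proof
  assume id: "brace_ideal L B"
  then have add: "L \<lhd> add_monoid B" and mult: "L \<lhd> B"
    and act: "\<And>e l. e \<in> carrier E \<Longrightarrow> l \<in> L \<Longrightarrow> act e l \<in> L"
    by (auto simp: brace_ideal_def strong_left_ideal_def left_ideal_iff_act)
  interpret N: normal L "add_monoid B" by fact
  have sub: "subgroup (L \<times> \<eta> ` L) G"
    using subbrace_iff_subgroup_LE_Int_LH LE_Int_LH_eq[OF N.subgroup_axioms] N.subgroup_axioms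
      normal_imp_subgroup[OF mult] by (simp add: subbrace_def)
  have "g \<otimes>\<^bsub>G\<^esub> x \<otimes>\<^bsub>G\<^esub> inv\<^bsub>G\<^esub> g \<in> L \<times> \<eta> ` L"
    if g: "g \<in> carrier G" and x: "x \<in> L \<times> \<eta> ` L" for g x
  proof -
    obtain k c where k: "k \<in> carrier B" and c: "c \<in> carrier B" and gg: "g = (k, \<eta> c)"
      using g by (auto simp: sd.carrier_semidirect elim: eta_cases)
    obtain l m where l: "l \<in> L" "l \<in> carrier B" and m: "m \<in> L" "m \<in> carrier B"
      and xx: "x = (l, \<eta> m)"
      using x L by auto
    define m' where "m' = c \<otimes> m \<otimes> inv c"
    have m': "m' \<in> L" "m' \<in> carrier B"
      using normal.inv_op_closed2[OF mult c m(1)] L by (auto simp: m'_def)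
    have em': "\<eta> c \<otimes>\<^bsub>E\<^esub> \<eta> m \<otimes>\<^bsub>E\<^esub> inv\<^bsub>E\<^esub> \<eta> c = \<eta> m'"
      using c m by (simp add: m'_def)
    define l' where "l' = act (\<eta> c) l"
    have l': "l' \<in> L" "l' \<in> carrier B"
      using act[of "\<eta> c" l] c l L by (auto simp: l'_def)
    define d where "d = act (\<eta> m') k \<ominus> k"
    have ak: "act (\<eta> m') k \<in> carrier B"
      using m' k by (simp add: sd.act_closed)
    have d: "d \<in> L" "d \<in> carrier B"
      using act_eta_cong[OF id m'(1) k] L by (auto simp: d_def)
    have "act (\<eta> m') k = d \<oplus> k"
      using ak k by (simp add: d_def a_minus_def A.m_assoc)
    then have "k \<oplus> l' \<oplus> act (\<eta> m') (\<ominus> k) = (k \<oplus> l' \<oplus> \<ominus> k) \<oplus> \<ominus> d"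
      using m' k d l' by (simp add: sd.act_inv A.inv_mult_group A.m_assoc)
    also have "\<dots> \<in> L"
      using N.inv_op_closed2[of k l'] N.m_inv_closed[OF d(1)] k l'
        N.m_closed[of "k \<oplus> l' \<oplus> \<ominus> k" "\<ominus> d"] by (simp add: a_inv_def)
    finally show ?thesis
      using k c l m m' by (simp add: gg xx sd.conj_semidirect em' l'_def)
  qed
  then show "LE \<inter> LH \<lhd> G"
    unfolding LE_Int_LH_eq[OF N.subgroup_axioms] sd.P.normal_inv_iff using sub by blast
next
  assume X: "LE \<inter> LH \<lhd> G"
  then have "\<zero> \<in> L"
    using normal_imp_subgroup[OF X] subgroup.one_closed
    by (fastforce simp: subbrace_iff_subgroup_LE_Int_LH[symmetric] subbrace_def)
  have "embed_K E ` carrier B \<lhd> G"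
    using sd.normal_embed_K_iff[of "carrier B"] sd.act_closed
      A.normal_invI[OF A.subgroup_self] by auto
  then have "embed_K E ` carrier B \<inter> (LE \<inter> LH) \<lhd> G"
    using X by (rule sd.P.normal_subgroup_intersect)
  moreover have "embed_K E ` carrier B \<inter> (LE \<inter> LH) = embed_K E ` L"
  proof (intro equalityI subsetI)
    fix x assume "x \<in> embed_K E ` carrier B \<inter> (LE \<inter> LH)"
    then show "x \<in> embed_K E ` L"
      unfolding LE_eq by (auto simp: embed_K_def)
  qed (use embed_subset_LE_Int_LH L in blast)
  moreover have "graph ` L \<lhd> G\<lparr>carrier := H\<rparr>"
    using sd.P.normal_Int_subgroup[OF subgroup_tri_H X] LE_Int_LH_Int_H[OF \<open>\<zero> \<in> L\<close>]
    by simp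
  ultimately show "brace_ideal L B"
    unfolding brace_ideal_iff_normal_H LE_Int_H by simp
qed

end

end

theorem proposition5p2:
  fixes B :: "('a, 'b) ring_scheme" and E :: "('e, 'c) monoid_scheme" and \<eta> :: "'a \<Rightarrow> 'e"
    and L :: "'a set" and G :: "('a \<times> 'e) monoid" and H E\<^sub>G L\<^sub>G :: "('a \<times> 'e) set"
  assumes "trifactorised_group B E \<eta>"
    and "L \<subseteq> carrier B"
    and "G = tri_G B E \<eta>"
    and "H = tri_H B E \<eta>"
    and "E\<^sub>G = embed_E B ` carrier E"
    and "L\<^sub>G = embed_K E ` L"
  shows
    "((subbrace L B \<longleftrightarrow>
         subgroup L (add_monoid B) \<and>
         subgroup ((L\<^sub>G <#>\<^bsub>G\<^esub> E\<^sub>G) \<inter> H) (G\<lparr>carrier := H\<rparr>)) \<and>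
      (subbrace L B \<longleftrightarrow>
         subgroup L (add_monoid B) \<and>
         subgroup ((L\<^sub>G <#>\<^bsub>G\<^esub> E\<^sub>G) \<inter> H) (G\<lparr>carrier := normalizer G L\<^sub>G\<rparr>)) \<and>
      (subbrace L B \<longleftrightarrow>
         subgroup ((L\<^sub>G <#>\<^bsub>G\<^esub> E\<^sub>G) \<inter> (L\<^sub>G <#>\<^bsub>G\<^esub> H)) G)) \<and>
     ((left_ideal L B \<longleftrightarrow>
         subgroup L (add_monoid B) \<and> subgroup E\<^sub>G (G\<lparr>carrier := normalizer G L\<^sub>G\<rparr>)) \<and>
      (left_ideal L B \<longleftrightarrow> subgroup (L\<^sub>G <#>\<^bsub>G\<^esub> E\<^sub>G) G)) \<and>
     (strong_left_ideal L B \<longleftrightarrow> L\<^sub>G \<lhd> G) \<and>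
     ((brace_ideal L B \<longleftrightarrow>
         L\<^sub>G \<lhd> G \<and> (L\<^sub>G <#>\<^bsub>G\<^esub> E\<^sub>G) \<inter> H \<lhd> G\<lparr>carrier := H\<rparr>) \<and>
      (brace_ideal L B \<longleftrightarrow> (L\<^sub>G <#>\<^bsub>G\<^esub> E\<^sub>G) \<inter> (L\<^sub>G <#>\<^bsub>G\<^esub> H) \<lhd> G))"
proof -
  interpret trifactorised_group B E \<eta> by fact
  show ?thesis
    unfolding assms(3-6)
    by (intro conjI subbrace_iff_subgroup_H subbrace_iff_subgroup_normalizer
        subbrace_iff_subgroup_LE_Int_LH left_ideal_iff_normalizer left_ideal_iff_subgroup_LE
        strong_left_ideal_iff_normal brace_ideal_iff_normal_H brace_ideal_iff_normal_LE_Int_LH assms(2))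
qed

end
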